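(* Let $f\colon\mathbb{N}\to\mathbb{N}$ be a function which tends to infinity. Then the following statements are equivalent: (1) There is a bijective function $\sigma\colon\mathbb{N}\to\mathbb{N}$ such that the series $\sum_{k=0}^\infty 2^{-f(\sigma(k))}$ converges computably. (2) The series $\sum_{k=0}^\infty 2^{-f^\ast(k)}$ converges computably. (3) The series $\sum_{k=0}^\infty u_f(k)\cdot 2^{-k}$ converges computably.
   Context: $\mathbb{N}=\{0,1,2,\dots\}$. A function $f\colon\mathbb{N}\to\mathbb{N}$ tends to infinity if for every $c\in\mathbb{N}$ there is $m$ with $f(n)>c$ for all $n\ge m$. For such $f$, $u_f(n) := |\{k\in\mathbb{N} \mid f(k)=n\}|$, and $f^\ast\colon\mathbb{N}\to\mathbb{N}$ denotes the unique non-decreasing (in the weak sense) unbounded function with $u_{f^\ast}=u_f$ (the sorted rearrangement of $f$). Neither $f$, $u_f$ nor $f^\ast$ nor $\sigma$ is assumed computable. A convergent sequence $(x_n)_n$ of reals with limit $x$ converges computably if there is a computable $s\colon\mathbb{N}\to\mathbb{N}$ with $|x-x_k|\le 2^{-n}$ for all $n$ and all $k\ge s(n)$; a series $\sum_k a_k$ converges computably if the sequence of its partial sums $\left(\sum_{k=0}^{n-1}a_k\right)_n$ converges and does so computably (no computability of the terms is required). *)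

theory Defs
  imports Complex_Main
begin

text \<open>Partial recursive functions, as programs with untyped arity. The relation
  \<open>computes p xs y\<close> says that \<open>p\<close> halts on the arguments \<open>xs\<close> with output \<open>y\<close>; \<open>Zero\<close> accepts
  any argument list and \<open>Proj i\<close> any list of length greater than \<open>i\<close>. For \<open>Mu\<close>, the values at
  all smaller candidates must be defined and nonzero.\<close>

datatype recf =
    Zero
  | Succ
  | Proj nat
  | Comp recf "recf list"
  | PrimRec recf recf
  | Mu recf

inductive computes :: "recf \<Rightarrow> nat list \<Rightarrow> nat \<Rightarrow> bool" where
  Zero: "computes Zero xs 0"
| Succ: "computes Succ [x] (Suc x)"
| Proj: "i < length xs \<Longrightarrow> computes (Proj i) xs (xs ! i)"
| Comp: "list_all2 (\<lambda>g y. computes g xs y) gs ys \<Longrightarrow> computes h ys z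
    \<Longrightarrow> computes (Comp h gs) xs z"
| PrimRec_0: "computes b xs z \<Longrightarrow> computes (PrimRec b h) (0 # xs) z"
| PrimRec_Suc: "computes (PrimRec b h) (n # xs) y \<Longrightarrow> computes h (n # y # xs) z
    \<Longrightarrow> computes (PrimRec b h) (Suc n # xs) z"
| Mu: "computes p (n # xs) 0 \<Longrightarrow> (\<forall>i<n. \<exists>y. computes p (i # xs) (Suc y))
    \<Longrightarrow> computes (Mu p) xs n"

inductive_cases computes_ZeroE: "computes Zero xs z"
inductive_cases computes_SuccE: "computes Succ xs z"
inductive_cases computes_ProjE: "computes (Proj i) xs z"
inductive_cases computes_CompE: "computes (Comp h gs) xs z"
inductive_cases computes_PrimRec_0E: "computes (PrimRec b h) (0 # xs) z"
inductive_cases computes_PrimRec_SucE: "computes (PrimRec b h) (Suc n # xs) z"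
inductive_cases computes_MuE: "computes (Mu p) xs z"

lemma computes_deterministic:
  "computes p xs y \<Longrightarrow> computes p xs z \<Longrightarrow> y = z"
proof (induction arbitrary: z rule: computes.induct)
  case (Comp xs gs ys h w)
  from Comp.prems obtain ys' where
    ys': "list_all2 (\<lambda>g y. computes g xs y) gs ys'" "computes h ys' z"
    by (rule computes_CompE)
  have "ys = ys'"
    using Comp.IH(1) ys'(1) by (auto simp: list_all2_conv_all_nth intro!: nth_equalityI)
  with Comp.IH(2) ys'(2) show ?case by blast
next
  case (PrimRec_Suc b h n xs y w)
  from PrimRec_Suc.prems obtain y' where
    "computes (PrimRec b h) (n # xs) y'" "computes h (n # y' # xs) z"
    by (rule computes_PrimRec_SucE)
  with PrimRec_Suc.IH show ?case by blast
next
  case (Mu p n xs)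
  from Mu.prems have z: "computes p (z # xs) 0" "\<forall>i<z. \<exists>y. computes p (i # xs) (Suc y)"
    by (blast elim: computes_MuE)+
  show ?case
  proof (cases n z rule: linorder_cases)
    case less
    with z(2) Mu.IH(1) show ?thesis by blast
  next
    case greater
    with z(1) Mu.IH(2) show ?thesis by blast
  qed
qed (blast elim: computes_ZeroE computes_SuccE computes_ProjE computes_PrimRec_0E)+

definition computable :: "(nat \<Rightarrow> nat) \<Rightarrow> bool" where
  "computable s \<longleftrightarrow> (\<exists>p. \<forall>n. computes p [n] (s n))"

definition converges_computably :: "(nat \<Rightarrow> real) \<Rightarrow> bool" where
  "converges_computably x \<longleftrightarrow>
    (\<exists>l. x \<longlonglongrightarrow> l \<and>
      (\<exists>s. computable s \<and> (\<forall>n. \<forall>k \<ge> s n. \<bar>l - x k\<bar> \<le> 1 / 2 ^ n)))"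

definition series_converges_computably :: "(nat \<Rightarrow> real) \<Rightarrow> bool" where
  "series_converges_computably a \<longleftrightarrow> converges_computably (\<lambda>n. \<Sum>k<n. a k)"

text \<open>\<open>card\<close> is \<open>0\<close> on infinite sets, but all the fibres are finite when \<open>f\<close> tends to infinity,
  and likewise when \<open>f\<close> is non-decreasing and unbounded.\<close>

definition fibre_card :: "(nat \<Rightarrow> nat) \<Rightarrow> nat \<Rightarrow> nat" where
  "fibre_card f n = card {k. f k = n}"

text \<open>For \<open>f\<close> tending to infinity there is exactly one function as described.\<close>

definition sorted_rearrangement :: "(nat \<Rightarrow> nat) \<Rightarrow> nat \<Rightarrow> nat" where
  "sorted_rearrangement f =
    (THE g. mono g \<and> \<not> bdd_above (range g) \<and> fibre_card g = fibre_card f)"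

end

theory Submission
  imports Defs
begin

text \<open>Each of the three series lists the same positive terms in some order or grouping, so only
  the moduli of convergence have to be compared. For non-negative terms a modulus \<open>s\<close> is the same
  as a function for which every finite sum of terms with indices from \<open>s m\<close> on is at most
  \<open>1 / 2 ^ m\<close> (\<open>series_converges_computably_nonneg_iff\<close>). In this form regrouping a series
  along the fibres of \<open>f\<close> is a finite computation (\<open>sum_fibre_card\<close>), and the equivalence is
  proved in a cycle.

  From a rearrangement to the series over the values (\<open>converges_by_value\<close>): among the first
  \<open>s (m + 1)\<close> terms \<open>1 / 2 ^ h k\<close>, those with \<open>h k \<ge> t\<close> contribute at most \<open>s (m + 1) / 2 ^ t\<close>, and
  all later terms together at most \<open>1 / 2 ^ (m + 1)\<close>; so \<open>t = s (m + 1) + m + 1\<close> suffices.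

  From the values to the sorted series (\<open>sorted_converges\<close>): the terms
  \<open>fibre_card f n / 2 ^ n\<close> are bounded
  by some natural number \<open>C\<close>, so at most \<open>C * 2 ^ N\<close> indices have a value below \<open>N\<close>. In a sorted
  sequence these come first, hence all indices from \<open>C * 2 ^ s m\<close> on have values at least \<open>s m\<close>.

  From the sorted series to a rearrangement: two functions whose fibres are finite and of equal
  size differ by a permutation of the indices (\<open>rearrangement_if_fibre_card_eq\<close>).

  In both estimates the new modulus arises from the old one by composition, addition and
  \<open>n \<mapsto> C * 2 ^ n\<close>, and is therefore computable, although \<open>f\<close> need not be.\<close>

section \<open>Computable moduli\<close>

lemma computable_Suc: "computable Suc"
  unfolding computable_def by (blast intro: computes.Succ)

lemma computable_compose:
  assumes "computable s" "computable t"
  shows "computable (\<lambda>n. s (t n))"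
proof -
  from assms obtain p q where "\<And>n. computes p [n] (s n)" "\<And>n. computes q [n] (t n)"
    unfolding computable_def by blast
  then have "computes (Comp p [q]) [n] (s (t n))" for n
    by (intro computes.Comp[where ys = "[t n]"]) auto
  then show ?thesis
    unfolding computable_def by blast
qed

definition add_program :: recf where
  "add_program = PrimRec (Proj 0) (Comp Succ [Proj 1])"

lemma computes_add_program: "computes add_program [m, n] (m + n)"
proof (induction m)
  case 0
  have "computes (Proj 0) [n] ([n] ! 0)"
    by (rule computes.Proj) simp
  then show ?case
    unfolding add_program_def by (auto intro: computes.PrimRec_0)
next
  case (Suc m)
  have "computes (Proj 1) [m, m + n, n] ([m, m + n, n] ! 1)"
    by (rule computes.Proj) simp
  then have "computes (Comp Succ [Proj 1]) [m, m + n, n] (Suc (m + n))"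
    by (intro computes.Comp[where ys = "[m + n]"] computes.Succ) auto
  with Suc show ?case
    unfolding add_program_def by (auto intro: computes.PrimRec_Suc)
qed

lemma computable_add:
  assumes "computable s" "computable t"
  shows "computable (\<lambda>n. s n + t n)"
proof -
  from assms obtain p q where "\<And>n. computes p [n] (s n)" "\<And>n. computes q [n] (t n)"
    unfolding computable_def by blast
  then have "computes (Comp add_program [p, q]) [n] (s n + t n)" for n
    by (intro computes.Comp[where ys = "[s n, t n]"] computes_add_program) auto
  then show ?thesis
    unfolding computable_def by blast
qed

lemma ex_computes_const: "\<exists>p. \<forall>xs. computes p xs c"
proof (induction c)
  case 0
  show ?case by (blast intro: computes.Zero)
next
  case (Suc c)
  then obtain p where "\<And>xs. computes p xs c" by blast
  then have "computes (Comp Succ [p]) xs (Suc c)" for xs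
    by (intro computes.Comp[where ys = "[c]"] computes.Succ) auto
  then show ?case by blast
qed

lemma computable_const_mult_power2: "computable (\<lambda>n. c * 2 ^ n)"
proof -
  obtain p where p: "\<And>xs. computes p xs c"
    using ex_computes_const by blast
  let ?double = "Comp add_program [Proj 1, Proj 1]"
  have "computes (PrimRec p ?double) [n] (c * 2 ^ n)" for n
  proof (induction n)
    case 0
    show ?case using p by (auto intro: computes.PrimRec_0)
  next
    case (Suc n)
    let ?y = "c * 2 ^ n"
    have "computes (Proj 1) [n, ?y] ([n, ?y] ! 1)"
      by (rule computes.Proj) simp
    then have "computes ?double [n, ?y] (?y + ?y)"
      by (intro computes.Comp[where ys = "[?y, ?y]"] computes_add_program) auto
    with Suc have "computes (PrimRec p ?double) [Suc n] (?y + ?y)"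
      by (auto intro: computes.PrimRec_Suc)
    then show ?case by (simp add: mult_2 algebra_simps)
  qed
  then show ?thesis
    unfolding computable_def by blast
qed

section \<open>Computable convergence of non-negative series\<close>

text \<open>Bounding finite sums over arbitrary sets of late indices, instead of the distance to the
  limit, makes reordering and regrouping the terms elementary: no limit has to be named, and
  convergence itself follows from the bound.\<close>

lemma series_converges_computably_nonneg_iff:
  fixes a :: "nat \<Rightarrow> real"
  assumes nonneg: "\<And>k. 0 \<le> a k"
  shows "series_converges_computably a \<longleftrightarrow>
    (\<exists>s. computable s \<and> (\<forall>m F. finite F \<longrightarrow> F \<subseteq> {s m..} \<longrightarrow> sum a F \<le> 1 / 2 ^ m))"
    (is "_ \<longleftrightarrow> (\<exists>s. computable s \<and> ?tail s)")
proof -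
  define x where "x = (\<lambda>n. \<Sum>k<n. a k)"
  have incseq: "incseq x"
    unfolding x_def by (auto intro!: incseq_SucI simp: nonneg)
  have diff: "x N - x n = sum a {n..<N}" if "n \<le> N" for n N
    unfolding x_def using that
    by (metis add_diff_cancel_left' atLeast0LessThan le0 sum.atLeastLessThan_concat)
  show ?thesis
  proof
    assume "series_converges_computably a"
    then obtain l s where l: "x \<longlonglongrightarrow> l" and s: "computable s"
      and mod: "\<And>n k. k \<ge> s n \<Longrightarrow> \<bar>l - x k\<bar> \<le> 1 / 2 ^ n"
      unfolding series_converges_computably_def converges_computably_def x_def by blast
    have "sum a F \<le> 1 / 2 ^ m" if F: "finite F" "F \<subseteq> {s m..}" for m F
    proof -
      define M where "M = max (Suc (Max F)) (s m)"
      have "k < M" if "k \<in> F" for k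
        using Max_ge[OF F(1) that] by (simp add: M_def)
      have "sum a F \<le> sum a {s m..<M}"
        using F \<open>\<And>k. k \<in> F \<Longrightarrow> k < M\<close> by (intro sum_mono2) (auto simp: nonneg)
      also have "\<dots> = x M - x (s m)"
        by (simp add: diff M_def)
      also have "\<dots> \<le> l - x (s m)"
        using incseq_le[OF incseq l] by simp
      also have "\<dots> \<le> 1 / 2 ^ m"
        using mod[of m "s m"] by simp
      finally show ?thesis .
    qed
    with s show "\<exists>s. computable s \<and> ?tail s" by blast
  next
    assume "\<exists>s. computable s \<and> ?tail s"
    then obtain s where s: "computable s" and tail: "?tail s" by blast
    have close: "x N - x k \<le> 1 / 2 ^ n" if "s n \<le> k" "k \<le> N" for n k N
    proof -
      have "{k..<N} \<subseteq> {s n..}" using that by auto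
      with tail that show ?thesis by (simp add: diff)
    qed
    have "x N \<le> x (s 0) + 1" for N
    proof -
      have "x N \<le> x (max N (s 0))"
        using incseq by (simp add: incseqD)
      also have "\<dots> \<le> x (s 0) + 1"
        using close[of 0 "s 0" "max N (s 0)"] by simp
      finally show ?thesis .
    qed
    then obtain l where l: "x \<longlonglongrightarrow> l" and le: "\<And>n. x n \<le> l"
      using incseq_convergent[OF incseq, of "x (s 0) + 1"] by blast
    have "\<bar>l - x k\<bar> \<le> 1 / 2 ^ n" if "k \<ge> s n" for n k
    proof -
      have "(\<lambda>N. x N - x k) \<longlonglongrightarrow> l - x k"
        using l by (intro tendsto_diff tendsto_const)
      then have "l - x k \<le> 1 / 2 ^ n"
        using close[OF that] by (intro LIMSEQ_le_const2) auto
      with le[of k] show ?thesis by simp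
    qed
    with l s show "series_converges_computably a"
      unfolding series_converges_computably_def converges_computably_def x_def[symmetric]
      by blast
  qed
qed

section \<open>Fibres and sorted rearrangements\<close>

lemma finite_vimage_if_finite_fibres:
  assumes "\<And>n. finite {k. h k = n}" and "finite F"
  shows "finite (h -` F)"
proof -
  have "h -` F = (\<Union>n\<in>F. {k. h k = n})" by auto
  with assms show ?thesis by simp
qed

lemma sum_fibre_card:
  fixes w :: "nat \<Rightarrow> 'a::comm_semiring_1"
  assumes fin: "\<And>n. finite {k. h k = n}" and "finite F"
  shows "(\<Sum>n\<in>F. of_nat (fibre_card h n) * w n) = (\<Sum>k\<in>h -` F. w (h k))"
proof -
  have "(\<Sum>k\<in>h -` F. w (h k)) = (\<Sum>n\<in>F. \<Sum>k\<in>{k\<in>h -` F. h k = n}. w (h k))"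
    by (rule sum.group[symmetric])
      (use assms in \<open>auto intro: finite_vimage_if_finite_fibres\<close>)
  also have "\<dots> = (\<Sum>n\<in>F. of_nat (fibre_card h n) * w n)"
  proof (rule sum.cong)
    fix n assume "n \<in> F"
    then have "{k\<in>h -` F. h k = n} = {k. h k = n}" by auto
    then show "(\<Sum>k\<in>{k\<in>h -` F. h k = n}. w (h k)) = of_nat (fibre_card h n) * w n"
      by (simp add: fibre_card_def)
  qed simp
  finally show ?thesis ..
qed

lemma card_vimage_lessThan:
  assumes "\<And>n. finite {k. h k = n}"
  shows "card (h -` {..<n}) = (\<Sum>i<n. fibre_card h i)"
  using sum_fibre_card[OF assms, of "{..<n}" "\<lambda>_. 1 :: nat"] by simp

lemma finite_fibres_if_filterlim_at_top:
  fixes f :: "nat \<Rightarrow> nat"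
  assumes "filterlim f at_top sequentially"
  shows "finite {k. f k = n}"
proof -
  have "eventually (\<lambda>k. Suc n \<le> f k) sequentially"
    using assms by (simp add: filterlim_at_top)
  then obtain N where "\<And>k. k \<ge> N \<Longrightarrow> Suc n \<le> f k"
    by (auto simp: eventually_sequentially)
  then have "{k. f k = n} \<subseteq> {..<N}"
    by (metis (mono_tags, lifting) lessThan_iff mem_Collect_eq not_less not_less_eq_eq order_refl subsetI)
  then show ?thesis
    by (rule finite_subset) simp
qed

lemma finite_fibres_if_mono_unbounded:
  fixes g :: "nat \<Rightarrow> nat"
  assumes "mono g" "\<not> bdd_above (range g)"
  shows "finite {k. g k = n}"
proof -
  obtain j where j: "n < g j"
    using assms(2) by (metis bdd_aboveI2 not_less)
  have "{k. g k = n} \<subseteq> {..<j}"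
  proof
    fix k assume "k \<in> {k. g k = n}"
    with j have "g k < g j" by simp
    then show "k \<in> {..<j}"
      using assms(1) by (metis lessThan_iff monoD not_less)
  qed
  then show ?thesis
    by (rule finite_subset) simp
qed

text \<open>The indices of a non-decreasing sequence at which the values are below \<open>n\<close> form an initial
  segment, so their number decides which indices these are. This determines the sequence.\<close>

lemma mono_less_iff_less_sum_fibre_card:
  fixes g :: "nat \<Rightarrow> nat"
  assumes mono: "mono g" and fin: "\<And>n. finite {k. g k = n}"
  shows "g k < n \<longleftrightarrow> k < (\<Sum>i<n. fibre_card g i)"
proof -
  let ?A = "g -` {..<n}"
  have "finite ?A"
    by (rule finite_vimage_if_finite_fibres[OF fin]) simp
  have "g k < n \<longleftrightarrow> k < card ?A"
  proof
    assume "g k < n"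
    then have "{..k} \<subseteq> ?A"
      using monoD[OF mono] by (fastforce intro: le_less_trans)
    from card_mono[OF \<open>finite ?A\<close> this] show "k < card ?A" by simp
  next
    assume k: "k < card ?A"
    show "g k < n"
    proof (rule ccontr)
      assume "\<not> g k < n"
      have "?A \<subseteq> {..<k}"
      proof
        fix j assume "j \<in> ?A"
        with \<open>\<not> g k < n\<close> have "g j < g k" by simp
        then show "j \<in> {..<k}"
          using mono by (metis lessThan_iff monoD not_less)
      qed
      then have "card ?A \<le> k"
        using card_mono[of "{..<k}" ?A] by simp
      with k show False by simp
    qed
  qed
  then show ?thesis
    by (simp add: card_vimage_lessThan[OF fin])
qed

lemma ex1_sorted_rearrangement:
  fixes f :: "nat \<Rightarrow> nat"
  assumes fin: "\<And>n. finite {k. f k = n}"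
  shows "\<exists>!g. mono g \<and> \<not> bdd_above (range g) \<and> fibre_card g = fibre_card f"
proof (rule ex_ex1I)
  define U where "U n = (\<Sum>i<n. fibre_card f i)" for n
  have U_mono: "U m \<le> U n" if "m \<le> n" for m n
    unfolding U_def using that by (intro sum_mono2) auto
  have U_unbounded: "\<exists>n. k < U (Suc n)" for k
  proof -
    define n where "n = Max (f ` {..k})"
    have "{..k} \<subseteq> f -` {..<Suc n}"
      by (auto simp: n_def less_Suc_eq_le)
    then have "card {..k} \<le> U (Suc n)"
      unfolding U_def card_vimage_lessThan[OF fin, symmetric]
      by (intro card_mono finite_vimage_if_finite_fibres[OF fin]) auto
    then show ?thesis by (auto simp: Suc_le_eq)
  qed
  \<comment> \<open>The required property \<open>g k < n \<longleftrightarrow> k < U n\<close> leaves no other choice for \<open>g\<close>.\<close>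
  define g where "g k = (LEAST n. k < U (Suc n))" for k
  have g: "g k < n \<longleftrightarrow> k < U n" for k n
  proof
    assume "g k < n"
    have "k < U (Suc (g k))"
      unfolding g_def using U_unbounded by (rule LeastI_ex)
    also have "\<dots> \<le> U n"
      using \<open>g k < n\<close> by (intro U_mono) simp
    finally show "k < U n" .
  next
    assume k: "k < U n"
    then obtain m where "n = Suc m"
      by (cases n) (auto simp: U_def)
    with k show "g k < n"
      by (auto simp: g_def less_Suc_eq_le intro: Least_le)
  qed
  have "mono g"
  proof (rule monoI)
    fix j k :: nat assume "j \<le> k"
    moreover have "k < U (Suc (g k))"
      using g[of k "Suc (g k)"] by simp
    ultimately have "g j < Suc (g k)"
      by (simp add: g)
    then show "g j \<le> g k" by simp
  qed
  moreover have "\<not> bdd_above (range g)"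
  proof
    assume "bdd_above (range g)"
    then obtain B where "\<And>k. g k \<le> B"
      by (auto simp: bdd_above_def)
    then have "U (Suc B) < U (Suc B)"
      using g[of "U (Suc B)" "Suc B"] by (simp add: less_Suc_eq_le)
    then show False by simp
  qed
  moreover have "fibre_card g = fibre_card f"
  proof
    fix n
    have "{k. g k = n} = {k. \<not> g k < n \<and> g k < Suc n}" by auto
    also have "\<dots> = {U n..<U (Suc n)}"
      unfolding g by auto
    finally have "{k. g k = n} = {U n..<U (Suc n)}" .
    then show "fibre_card g n = fibre_card f n"
      by (simp add: fibre_card_def[of g] U_def)
  qed
  ultimately show "\<exists>g. mono g \<and> \<not> bdd_above (range g) \<and> fibre_card g = fibre_card f"
    by (intro exI[of _ g] conjI)
next
  fix g h :: "nat \<Rightarrow> nat"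
  assume g: "mono g \<and> \<not> bdd_above (range g) \<and> fibre_card g = fibre_card f"
    and h: "mono h \<and> \<not> bdd_above (range h) \<and> fibre_card h = fibre_card f"
  have "g k < n \<longleftrightarrow> h k < n" for k n
    using g h by (simp add: mono_less_iff_less_sum_fibre_card finite_fibres_if_mono_unbounded)
  then show "g = h"
    by (metis ext less_irrefl linorder_neqE_nat)
qed

lemma rearrangement_if_fibre_card_eq:
  fixes f g :: "nat \<Rightarrow> nat"
  assumes fin_f: "\<And>n. finite {k. f k = n}" and fin_g: "\<And>n. finite {k. g k = n}"
    and eq: "fibre_card g = fibre_card f"
  obtains \<sigma> where "bij \<sigma>" "\<And>k. f (\<sigma> k) = g k"
proof -
  have "\<exists>b. bij_betw b {k. g k = n} {k. f k = n}" for n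
    using fun_cong[OF eq, of n]
    by (intro finite_same_card_bij fin_f fin_g) (simp add: fibre_card_def)
  then obtain b where b: "\<And>n. bij_betw (b n) {k. g k = n} {k. f k = n}"
    by metis
  define \<sigma> where "\<sigma> k = b (g k) k" for k
  have f\<sigma>: "f (\<sigma> k) = g k" for k
    using bij_betwE[OF b[of "g k"]] by (auto simp: \<sigma>_def)
  have "inj \<sigma>"
  proof (rule injI)
    fix j k assume jk: "\<sigma> j = \<sigma> k"
    then have "g j = g k"
      using f\<sigma> by metis
    with jk show "j = k"
      using bij_betw_imp_inj_on[OF b[of "g k"]] by (auto simp: \<sigma>_def inj_on_def)
  qed
  moreover have "surj \<sigma>"
  proof -
    have "\<exists>k. y = \<sigma> k" for y
    proof -
      have "y \<in> b (f y) ` {k. g k = f y}"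
        using bij_betw_imp_surj_on[OF b[of "f y"]] by simp
      then obtain k where "g k = f y" "y = b (f y) k" by auto
      then have "y = \<sigma> k" by (simp add: \<sigma>_def)
      then show ?thesis ..
    qed
    then show ?thesis by (auto simp: surj_def)
  qed
  ultimately show ?thesis
    using that f\<sigma> by (auto simp: bij_def)
qed

section \<open>Comparison of the moduli\<close>

lemma converges_by_value:
  fixes h :: "nat \<Rightarrow> nat"
  assumes fin: "\<And>n. finite {k. h k = n}"
    and conv: "series_converges_computably (\<lambda>k. 1 / 2 ^ h k)"
  shows "series_converges_computably (\<lambda>n. real (fibre_card h n) * (1 / 2 ^ n))"
proof -
  obtain s where s: "computable s"
    and tail: "\<And>m F. finite F \<Longrightarrow> F \<subseteq> {s m..} \<Longrightarrow> (\<Sum>k\<in>F. 1 / 2 ^ h k) \<le> (1 / 2 ^ m :: real)"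
    using conv by (auto simp: series_converges_computably_nonneg_iff)
  define t where "t m = s (Suc m) + Suc m" for m
  have "computable t"
    unfolding t_def by (intro computable_add computable_compose[OF s] computable_Suc)
  moreover have "(\<Sum>n\<in>F. real (fibre_card h n) * (1 / 2 ^ n)) \<le> 1 / 2 ^ m"
    if F: "finite F" "F \<subseteq> {t m..}" for m F
  proof -
    define N where "N = s (Suc m)"
    let ?w = "\<lambda>k. 1 / 2 ^ h k :: real"
    have finite: "finite (h -` F)"
      by (rule finite_vimage_if_finite_fibres[OF fin F(1)])
    have "(\<Sum>n\<in>F. real (fibre_card h n) * (1 / 2 ^ n)) = sum ?w (h -` F)"
      by (rule sum_fibre_card[OF fin F(1)])
    also have "\<dots> = sum ?w (h -` F \<inter> {..<N}) + sum ?w (h -` F \<inter> {N..})"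
      using finite by (subst sum.union_disjoint[symmetric]) (auto intro!: sum.cong)
    also have "sum ?w (h -` F \<inter> {..<N}) \<le> (\<Sum>k<N. 1 / 2 ^ t m)"
    proof -
      have "?w k \<le> 1 / 2 ^ t m" if "k \<in> h -` F" for k
        using that F(2) by (auto intro!: divide_left_mono power_increasing)
      then have "sum ?w (h -` F \<inter> {..<N}) \<le> (\<Sum>k\<in>h -` F \<inter> {..<N}. 1 / 2 ^ t m)"
        by (intro sum_mono) auto
      also have "\<dots> \<le> (\<Sum>k<N. 1 / 2 ^ t m)"
        by (intro sum_mono2) auto
      finally show ?thesis .
    qed
    also have "(\<Sum>k<N. 1 / 2 ^ t m) \<le> (1 / 2 ^ Suc m :: real)"
    proof -
      have "real N \<le> 2 ^ N"
        using of_nat_less_two_power[of N, where 'a = real] by simp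
      then show ?thesis
        by (simp add: t_def N_def[symmetric] power_add field_simps)
    qed
    also have "sum ?w (h -` F \<inter> {N..}) \<le> 1 / 2 ^ Suc m"
      using finite by (intro tail) (auto simp: N_def)
    finally show ?thesis by simp
  qed
  ultimately show ?thesis
    by (subst series_converges_computably_nonneg_iff) auto
qed

lemma sorted_converges:
  fixes g :: "nat \<Rightarrow> nat"
  assumes mono: "mono g" and unbounded: "\<not> bdd_above (range g)"
    and conv: "series_converges_computably (\<lambda>n. real (fibre_card g n) * (1 / 2 ^ n))"
  shows "series_converges_computably (\<lambda>k. 1 / 2 ^ g k)"
proof -
  let ?u = "\<lambda>n. real (fibre_card g n) * (1 / 2 ^ n)"
  have fin: "finite {k. g k = n}" for n
    by (rule finite_fibres_if_mono_unbounded[OF mono unbounded])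
  obtain s where s: "computable s"
    and tail: "\<And>m F. finite F \<Longrightarrow> F \<subseteq> {s m..} \<Longrightarrow> sum ?u F \<le> 1 / 2 ^ m"
    using conv by (auto simp: series_converges_computably_nonneg_iff)
  \<comment> \<open>Only the existence of \<open>C\<close> matters: any constant is computable.\<close>
  obtain C :: nat where C: "\<And>n. fibre_card g n \<le> C * 2 ^ n"
  proof
    fix n
    show "fibre_card g n \<le> Suc (\<Sum>i<s 0. fibre_card g i) * 2 ^ n"
    proof (cases "n < s 0")
      case True
      then have "fibre_card g n \<le> (\<Sum>i<s 0. fibre_card g i)"
        by (intro member_le_sum) auto
      also have "\<dots> \<le> Suc (\<Sum>i<s 0. fibre_card g i) * 1" by simp
      also have "\<dots> \<le> Suc (\<Sum>i<s 0. fibre_card g i) * 2 ^ n"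
        by (intro mult_le_mono) auto
      finally show ?thesis .
    next
      case False
      then have "real (fibre_card g n) \<le> real (2 ^ n)"
        using tail[of "{n}" 0] by (simp add: field_simps)
      then have "fibre_card g n \<le> 2 ^ n"
        by (simp only: of_nat_le_iff)
      then show ?thesis by simp
    qed
  qed
  have few: "(\<Sum>i<n. fibre_card g i) \<le> C * 2 ^ n" for n
  proof (induction n)
    case (Suc n)
    with C[of n] show ?case by simp
  qed simp
  define t where "t m = C * 2 ^ s m" for m
  have "computable t"
    unfolding t_def by (rule computable_compose[OF computable_const_mult_power2 s])
  moreover have "(\<Sum>k\<in>F. 1 / 2 ^ g k) \<le> (1 / 2 ^ m :: real)"
    if F: "finite F" "F \<subseteq> {t m..}" for m F
  proof -
    have late: "g ` F \<subseteq> {s m..}"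
    proof
      fix n assume "n \<in> g ` F"
      then obtain k where k: "n = g k" "t m \<le> k"
        using F(2) by auto
      then have "\<not> k < (\<Sum>i<s m. fibre_card g i)"
        using few[of "s m"] by (simp add: t_def)
      then show "n \<in> {s m..}"
        using mono_less_iff_less_sum_fibre_card[OF mono fin, of k "s m"] k(1) by simp
    qed
    have "(\<Sum>k\<in>F. 1 / 2 ^ g k) \<le> (\<Sum>k\<in>g -` (g ` F). 1 / 2 ^ g k :: real)"
      using F(1) by (intro sum_mono2 finite_vimage_if_finite_fibres[OF fin]) auto
    also have "\<dots> = sum ?u (g ` F)"
      using F(1) by (intro sum_fibre_card[OF fin, symmetric]) simp
    also have "\<dots> \<le> 1 / 2 ^ m"
      using F(1) late by (intro tail) auto
    finally show ?thesis .
  qed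
  ultimately show ?thesis
    by (subst series_converges_computably_nonneg_iff) auto
qed

theorem proposition5:
  fixes f :: "nat \<Rightarrow> nat"
  assumes "filterlim f at_top sequentially"
  shows "((\<exists>\<sigma> :: nat \<Rightarrow> nat. bij \<sigma> \<and> series_converges_computably (\<lambda>k. 1 / 2 ^ f (\<sigma> k)))
            \<longleftrightarrow> series_converges_computably (\<lambda>k. 1 / 2 ^ sorted_rearrangement f k))
       \<and> (series_converges_computably (\<lambda>k. 1 / 2 ^ sorted_rearrangement f k)
            \<longleftrightarrow> series_converges_computably (\<lambda>k. real (fibre_card f k) * (1 / 2 ^ k)))"
    (is "(?rearranged \<longleftrightarrow> ?sorted) \<and> (?sorted \<longleftrightarrow> ?by_value)")
proof -
  have fin: "finite {k. f k = n}" for n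
    by (rule finite_fibres_if_filterlim_at_top[OF assms])
  define g where "g = sorted_rearrangement f"
  have g: "mono g" "\<not> bdd_above (range g)" "fibre_card g = fibre_card f"
    using theI'[OF ex1_sorted_rearrangement[OF fin]]
    unfolding g_def sorted_rearrangement_def by auto
  have "?by_value" if "?rearranged"
  proof -
    from that obtain \<sigma> where \<sigma>: "bij \<sigma>"
      and conv: "series_converges_computably (\<lambda>k. 1 / 2 ^ f (\<sigma> k))" by blast
    have fibre: "{k. f (\<sigma> k) = n} = \<sigma> -` {k. f k = n}" for n by auto
    have "finite {k. f (\<sigma> k) = n}" for n
      unfolding fibre using fin \<sigma> by (intro finite_vimageI) (auto simp: bij_def)
    moreover have "fibre_card (\<lambda>k. f (\<sigma> k)) = fibre_card f"
    proof
      fix n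
      show "fibre_card (\<lambda>k. f (\<sigma> k)) n = fibre_card f n"
        unfolding fibre_card_def fibre using \<sigma> by (intro card_vimage_inj) (auto simp: bij_def)
    qed
    ultimately show ?thesis
      using converges_by_value[of "\<lambda>k. f (\<sigma> k)"] conv by simp
  qed
  moreover have "?sorted" if "?by_value"
    using sorted_converges[OF g(1,2)] that unfolding g(3) by (simp add: g_def)
  moreover have "?rearranged" if "?sorted"
  proof -
    obtain \<sigma> where "bij \<sigma>" "\<And>k. f (\<sigma> k) = g k"
      using rearrangement_if_fibre_card_eq[OF fin finite_fibres_if_mono_unbounded[OF g(1,2)] g(3)]
      by blast
    with that show ?thesis by (auto simp: g_def)
  qed
  ultimately show ?thesis by blast
qed

end
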